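(* Let $A\in\mathbb{R}^{n\times n}$ be invertible and symmetric, $M=I-A$, with distinct eigenvalues $a_1,\dots,a_p$ of $A$ and, for each $i$, an orthonormal basis $u_{i,1},\dots,u_{i,n_i}$ of the eigenspace of $a_i$. Then every eigenvector $u$ of the nonlinear eigenvalue problem $\Upsilon(u)u=\mu u$ associated with a nonzero eigenvalue $\mu$ is of the form $$u=\sum_{i\in J}\sum_{s=1}^{n_i}c_{i,s}u_{i,s},$$ where $J\subseteq\{1,\dots,p\}$ with $2\le \#J\le 4$ and, for each $i\in J$, at least one of the real coefficients $c_{i,1},\dots,c_{i,n_i}$ is nonzero.
   Context: $\langle\cdot,\cdot\rangle$ is the Euclidean inner product. For $0\neq v\in\mathbb{R}^n$, $\alpha(v)=\frac{\langle v,Av\rangle}{\langle Av,Av\rangle}$ and $\Psi(v)=M(I-\alpha(v)A)v$. For $v\neq0$ with $\Psi(v)\neq0$, $\Upsilon(v)=M(I-\alpha(\Psi(v))A)M(I-\alpha(v)A)$; $\Upsilon(v)$ is not defined when $\Psi(v)=0$, so such $v$ are not eigenvectors. A nonzero $u\in\mathbb{R}^n$ with $\Psi(u)\neq0$ is an eigenvector with eigenvalue $\mu$ if $\Upsilon(u)u=\mu u$. *)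

theory Defs
  imports "HOL-Analysis.Analysis"
begin

definition eigenspace :: "real ^ 'n ^ 'n \<Rightarrow> real \<Rightarrow> (real ^ 'n) set" where
  "eigenspace A a = {v. A *v v = a *\<^sub>R v}"

definition is_eigenvalue :: "real ^ 'n ^ 'n \<Rightarrow> real \<Rightarrow> bool" where
  "is_eigenvalue A a \<longleftrightarrow> (\<exists>v. v \<noteq> 0 \<and> A *v v = a *\<^sub>R v)"

definition orthonormal_basis :: "(real ^ 'n) set \<Rightarrow> nat \<Rightarrow> (nat \<Rightarrow> real ^ 'n) \<Rightarrow> bool" where
  "orthonormal_basis V m e \<longleftrightarrow>
     (\<forall>s\<in>{1..m}. \<forall>t\<in>{1..m}. e s \<bullet> e t = (if s = t then 1 else 0)) \<and>
     span (e ` {1..m}) = V"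

text \<open>
  The functions below are total. \<open>alpha A v\<close> is meaningful only for \<open>A *v v \<noteq> 0\<close> (otherwise it is
  \<open>0\<close> by the convention \<open>x / 0 = 0\<close>), and \<open>Upsilon A v\<close> only for \<open>v \<noteq> 0\<close> and \<open>Psi A v \<noteq> 0\<close>; the
  latter restriction is part of \<open>nonlinear_eigenvector\<close>.
\<close>

definition alpha :: "real ^ 'n ^ 'n \<Rightarrow> real ^ 'n \<Rightarrow> real" where
  "alpha A v = (v \<bullet> (A *v v)) / ((A *v v) \<bullet> (A *v v))"

definition M_of :: "real ^ 'n ^ 'n \<Rightarrow> real ^ 'n ^ 'n" where
  "M_of A = mat 1 - A"

definition Psi :: "real ^ 'n ^ 'n \<Rightarrow> real ^ 'n \<Rightarrow> real ^ 'n" where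
  "Psi A v = (M_of A ** (mat 1 - alpha A v *\<^sub>R A)) *v v"

definition Upsilon :: "real ^ 'n ^ 'n \<Rightarrow> real ^ 'n \<Rightarrow> real ^ 'n ^ 'n" where
  "Upsilon A v =
     M_of A ** (mat 1 - alpha A (Psi A v) *\<^sub>R A) ** M_of A ** (mat 1 - alpha A v *\<^sub>R A)"

text \<open>Since \<open>u\<close> and \<open>Upsilon A u\<close> are real, an eigenvalue is automatically real.\<close>

definition nonlinear_eigenvector :: "real ^ 'n ^ 'n \<Rightarrow> real \<Rightarrow> real ^ 'n \<Rightarrow> bool" where
  "nonlinear_eigenvector A \<mu> u \<longleftrightarrow> u \<noteq> 0 \<and> Psi A u \<noteq> 0 \<and> Upsilon A u *v u = \<mu> *\<^sub>R u"

end

theory Submission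
  imports Defs "HOL-Computational_Algebra.Polynomial"
begin

text \<open>
  Freeze the two step sizes at the eigenvector \<open>u\<close>: with \<open>\<alpha> = alpha A u\<close> and
  \<open>\<beta> = alpha A (Psi A u)\<close>, the matrix \<open>Upsilon A u\<close> is \<open>q(A)\<close> for the scalar polynomial
  \<open>q(t) = (1 - t)\<^sup>2 (1 - \<beta> t) (1 - \<alpha> t)\<close>. As \<open>A\<close> is symmetric, pairing \<open>q(A) u = \<mu> u\<close> with an
  eigenvector \<open>v\<close> of \<open>A\<close> for \<open>t\<close> gives \<open>q(t) (v \<bullet> u) = \<mu> (v \<bullet> u)\<close>, so every eigenspace of \<open>A\<close> in
  which \<open>u\<close> has a nonzero component belongs to a root of \<open>q - \<mu>\<close>. This polynomial has degree at
  most \<open>4\<close>, and it is not the zero polynomial because its value at \<open>1\<close> is \<open>- \<mu> \<noteq> 0\<close>. Hence at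
  most four components of \<open>u\<close> are nonzero.

  At least two are nonzero: if \<open>A u = t u\<close>, then \<open>alpha A u = 1 / t\<close>, the exact minimising step,
  which sends \<open>u\<close> to \<open>Psi A u = 0\<close>; this is excluded for an eigenvector of the nonlinear problem.

  That \<open>u\<close> is the sum of its components is the spectral theorem for real symmetric matrices. It is
  used in the form that only \<open>0\<close> is orthogonal to all eigenvectors: the orthogonal complement of
  the eigenvectors is \<open>A\<close>-invariant, and a maximiser of the Rayleigh quotient on it would be an
  eigenvector orthogonal to itself.
\<close>

section \<open>Symmetric matrices\<close>

lemma inner_matrix_vector_symmetric:
  fixes A :: "real ^ 'n ^ 'n"
  assumes "transpose A = A"
  shows "x \<bullet> (A *v y) = (A *v x) \<bullet> y"
  using dot_lmul_matrix[of x A y] assms by (metis transpose_matrix_vector)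

lemma inner_eigenvector_matrix_vector:
  fixes A :: "real ^ 'n ^ 'n"
  assumes "transpose A = A" "v \<in> eigenspace A t"
  shows "v \<bullet> (A *v w) = t * (v \<bullet> w)"
  using assms(2) by (simp add: inner_matrix_vector_symmetric[OF assms(1)] eigenspace_def)

lemma inner_eigenvectors_eq_0:
  fixes A :: "real ^ 'n ^ 'n"
  assumes "transpose A = A" "v \<in> eigenspace A s" "w \<in> eigenspace A t" "s \<noteq> t"
  shows "v \<bullet> w = 0"
proof -
  have "s * (v \<bullet> w) = t * (v \<bullet> w)"
    using inner_eigenvector_matrix_vector[OF assms(1,2), of w] assms(3)
    by (auto simp: eigenspace_def)
  then show ?thesis using assms(4) by auto
qed

text \<open>
  The eigenvector is a maximiser \<open>v\<close> of \<open>x \<bullet> A x\<close> on the unit sphere of \<open>S\<close>, with maximum \<open>t\<close>. The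
  form \<open>t (x \<bullet> x) - x \<bullet> A x\<close> is then nonnegative on \<open>S\<close> and vanishes at \<open>v\<close>, so its derivative at
  \<open>v\<close> vanishes in every direction of \<open>S\<close>; invariance of \<open>S\<close> allows the direction \<open>t v - A v\<close>.
\<close>

lemma symmetric_invariant_subspace_has_eigenvector:
  fixes A :: "real ^ 'n ^ 'n"
  assumes sym: "transpose A = A" and S: "subspace S"
    and inv: "\<And>x. x \<in> S \<Longrightarrow> A *v x \<in> S"
    and r: "r \<in> S" "r \<noteq> 0"
  obtains v t where "v \<in> S" "v \<noteq> 0" "v \<in> eigenspace A t"
proof -
  let ?K = "S \<inter> sphere 0 1"
  have "compact ?K"
    using closed_subspace[OF S] by (simp add: closed_Int_compact)
  moreover have "(1 / norm r) *\<^sub>R r \<in> ?K"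
    using r S by (simp add: subspace_scale)
  then have "?K \<noteq> {}" by blast
  moreover have "continuous_on ?K (\<lambda>x. x \<bullet> (A *v x))"
    by (intro continuous_intros matrix_vector_mult_linear_continuous_on)
  ultimately obtain v where v: "v \<in> ?K" and vmax: "\<And>x. x \<in> ?K \<Longrightarrow> x \<bullet> (A *v x) \<le> v \<bullet> (A *v v)"
    using continuous_attains_sup[of ?K "\<lambda>x. x \<bullet> (A *v x)"] by blast
  define t where "t = v \<bullet> (A *v v)"
  have vS: "v \<in> S" and vv: "v \<bullet> v = 1"
    using v by (auto simp: norm_eq_1)
  have nonneg: "x \<bullet> (A *v x) \<le> t * (x \<bullet> x)" if "x \<in> S" for x
  proof (cases "x = 0")
    case False
    have "(1 / norm x) *\<^sub>R x \<in> ?K"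
      using that S False by (simp add: subspace_scale)
    from vmax[OF this] have "(x \<bullet> (A *v x)) / (norm x)\<^sup>2 \<le> t"
      by (simp add: t_def matrix_vector_mult_scaleR power2_eq_square)
    then show ?thesis
      using False by (simp add: divide_le_eq power2_norm_eq_inner)
  qed simp
  define w where "w = t *\<^sub>R v - A *v v"
  have wS: "w \<in> S"
    unfolding w_def using vS inv S by (simp add: subspace_diff subspace_scale)
  define d where "d = t * (w \<bullet> w) - w \<bullet> (A *v w)"
  have d0: "0 \<le> d"
    using nonneg[OF wS] by (simp add: d_def)
  have quad: "0 \<le> 2 * h * (w \<bullet> w) + h\<^sup>2 * d" for h :: real
  proof -
    have "v + h *\<^sub>R w \<in> S"
      using vS wS S by (simp add: subspace_add subspace_scale)
    from nonneg[OF this]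
    have "0 \<le> t * ((v + h *\<^sub>R w) \<bullet> (v + h *\<^sub>R w)) - (v + h *\<^sub>R w) \<bullet> (A *v (v + h *\<^sub>R w))"
      by simp
    also have "\<dots> = 2 * h * (t * (v \<bullet> w) - (A *v v) \<bullet> w) + h\<^sup>2 * d"
      using inner_matrix_vector_symmetric[OF sym, of v w] vv
      by (simp add: matrix_vector_right_distrib matrix_vector_mult_scaleR inner_add_left
          inner_add_right inner_commute t_def[symmetric] d_def power2_eq_square algebra_simps)
    also have "t * (v \<bullet> w) - (A *v v) \<bullet> w = w \<bullet> w"
      by (simp add: w_def inner_diff_left)
    finally show ?thesis .
  qed
  have "w \<bullet> w = 0"
  proof (rule ccontr)
    assume "w \<bullet> w \<noteq> 0"
    then have pos: "0 < w \<bullet> w" by simp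
    (* For small negative h the linear term dominates; this h makes h * d > - (w \<bullet> w). *)
    define h where "h = - (w \<bullet> w) / (d + 1)"
    have h: "h < 0" "h * (d + 1) = - (w \<bullet> w)"
      using pos d0 by (auto simp: h_def divide_neg_pos)
    have "2 * h * (w \<bullet> w) + h\<^sup>2 * d = h * (2 * (w \<bullet> w) + h * d)"
      by (simp add: power2_eq_square algebra_simps)
    moreover have "0 < 2 * (w \<bullet> w) + h * d"
    proof -
      have "h * d = - (w \<bullet> w) - h" using h(2) by (simp add: distrib_left)
      then show ?thesis using h(1) pos by linarith
    qed
    ultimately show False
      using quad[of h] h(1) by (smt (verit) mult_neg_pos)
  qed
  then have "v \<in> eigenspace A t"
    by (simp add: w_def eigenspace_def)
  moreover have "v \<noteq> 0" using vv by auto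
  ultimately show ?thesis using that vS by blast
qed

lemma orthogonal_to_all_eigenvectors_eq_0:
  fixes A :: "real ^ 'n ^ 'n"
  assumes sym: "transpose A = A"
    and r: "\<And>t v. v \<in> eigenspace A t \<Longrightarrow> v \<bullet> r = 0"
  shows "r = 0"
proof (rule ccontr)
  assume "r \<noteq> 0"
  define S where "S = {x. \<forall>t. \<forall>v \<in> eigenspace A t. v \<bullet> x = 0}"
  have "subspace S"
    by (auto simp: S_def subspace_def inner_add_right)
  moreover have "A *v x \<in> S" if "x \<in> S" for x
    using that inner_eigenvector_matrix_vector[OF sym] by (auto simp: S_def)
  moreover have "r \<in> S" using r by (auto simp: S_def)
  ultimately obtain v t where "v \<in> S" "v \<noteq> 0" "v \<in> eigenspace A t"
    using symmetric_invariant_subspace_has_eigenvector[OF sym] \<open>r \<noteq> 0\<close> by metis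
  then have "v \<bullet> v = 0" unfolding S_def by blast
  then show False using \<open>v \<noteq> 0\<close> by simp
qed

lemma orthonormal_basis_in:
  assumes "orthonormal_basis V k e" "s \<in> {1..k}"
  shows "e s \<in> V"
  using assms by (auto simp: orthonormal_basis_def intro: span_base)

text \<open>
  The remainder of \<open>u\<close> after subtracting the expansion is orthogonal to all \<open>e i s\<close>, hence to every
  eigenvector.
\<close>

lemma symmetric_eigenbasis_expansion:
  fixes A :: "real ^ 'n ^ 'n" and p :: nat
  assumes sym: "transpose A = A" and inj: "inj_on a {1..p}"
    and spec: "a ` {1..p} = {l. is_eigenvalue A l}"
    and basis: "\<And>i. i \<in> {1..p} \<Longrightarrow> orthonormal_basis (eigenspace A (a i)) (m i) (e i)"
  shows "u = (\<Sum>i = 1..p. \<Sum>s = 1..m i. (e i s \<bullet> u) *\<^sub>R e i s)" (is "u = ?x")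
proof -
  have in_eig: "e i s \<in> eigenspace A (a i)" if "i \<in> {1..p}" "s \<in> {1..m i}" for i s
    using orthonormal_basis_in[OF basis] that by blast
  have inner_x: "e j r \<bullet> ?x = e j r \<bullet> u" if j: "j \<in> {1..p}" and r: "r \<in> {1..m j}" for j r
  proof -
    have "e j r \<bullet> (\<Sum>s = 1..m i. (e i s \<bullet> u) *\<^sub>R e i s) = (if i = j then e j r \<bullet> u else 0)"
      if i: "i \<in> {1..p}" for i
    proof (cases "i = j")
      case True
      have "e j r \<bullet> (\<Sum>s = 1..m j. (e j s \<bullet> u) *\<^sub>R e j s)
          = (\<Sum>s = 1..m j. if r = s then e j s \<bullet> u else 0)"
        using basis[OF j] r unfolding inner_sum_right orthonormal_basis_def
        by (intro sum.cong) auto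
      then show ?thesis using r True by simp
    next
      case False
      then have "a j \<noteq> a i" using inj i j by (auto dest: inj_onD)
      then have "e j r \<bullet> e i s = 0" if "s \<in> {1..m i}" for s
        using inner_eigenvectors_eq_0[OF sym in_eig[OF j r] in_eig[OF i that]] by simp
      then show ?thesis using False by (simp add: inner_sum_right)
    qed
    then have "e j r \<bullet> ?x = (\<Sum>i = 1..p. if i = j then e j r \<bullet> u else 0)"
      unfolding inner_sum_right[of _ _ "{1..p}"] by (intro sum.cong) auto
    then show ?thesis using j by simp
  qed
  have "v \<bullet> (u - ?x) = 0" if v: "v \<in> eigenspace A t" for v t
  proof (cases "v = 0")
    case False
    then have "is_eigenvalue A t"
      using v by (auto simp: is_eigenvalue_def eigenspace_def)
    then obtain j where j: "j \<in> {1..p}" "t = a j"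
      using spec by blast
    then have "v \<in> span (e j ` {1..m j})"
      using basis v by (auto simp: orthonormal_basis_def)
    moreover have "orthogonal (u - ?x) w" if w: "w \<in> e j ` {1..m j}" for w
    proof -
      have "w \<bullet> ?x = w \<bullet> u"
        using w inner_x[OF j(1)] by blast
      then show ?thesis
        by (simp only: orthogonal_def inner_commute[of _ w] inner_diff_right diff_self)
    qed
    ultimately have "orthogonal (u - ?x) v"
      by (rule orthogonal_to_span)
    then show ?thesis by (simp add: orthogonal_def inner_commute)
  qed simp
  then have "u - ?x = 0"
    using orthogonal_to_all_eigenvectors_eq_0[OF sym] by blast
  then show ?thesis by simp
qed

section \<open>The nonlinear eigenvalue problem\<close>

lemma M_of_mult_vector: "M_of A *v x = x - A *v x"
  by (simp add: M_of_def matrix_vector_mult_diff_rdistrib)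

lemma step_mult_vector:
  fixes A :: "real ^ 'n ^ 'n"
  shows "(mat 1 - c *\<^sub>R A) *v x = x - c *\<^sub>R (A *v x)"
  by (simp add: matrix_vector_mult_diff_rdistrib scaleR_matrix_vector_assoc)

lemma inner_eigenvector_Upsilon:
  fixes A :: "real ^ 'n ^ 'n"
  assumes sym: "transpose A = A" and v: "v \<in> eigenspace A t"
  shows "v \<bullet> (Upsilon A u *v x)
    = (1 - t)\<^sup>2 * (1 - alpha A (Psi A u) * t) * (1 - alpha A u * t) * (v \<bullet> x)"
  unfolding Upsilon_def matrix_vector_mul_assoc[symmetric] M_of_mult_vector step_mult_vector
    inner_diff_right inner_scaleR_right inner_eigenvector_matrix_vector[OF sym v]
  by (simp add: power2_eq_square algebra_simps)

lemma Psi_eigenvector_eq_0: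
  fixes A :: "real ^ 'n ^ 'n"
  assumes "u \<in> eigenspace A t" "t \<noteq> 0"
  shows "Psi A u = 0"
proof (cases "u = 0")
  case False
  have Au: "A *v u = t *\<^sub>R u" using assms(1) by (simp add: eigenspace_def)
  have "alpha A u = 1 / t"
    using False assms(2) by (simp add: alpha_def Au)
  then show ?thesis
    using assms(2)
    by (simp add: Psi_def matrix_vector_mul_assoc[symmetric] step_mult_vector Au)
qed (simp add: Psi_def)

text \<open>
  The assumption \<open>\<mu> \<noteq> 0\<close> keeps \<open>(1 - t)\<^sup>2 (1 - c t) (1 - b t) - \<mu>\<close> from being the zero polynomial,
  since its value at \<open>1\<close> is \<open>- \<mu>\<close>. Its degree is below \<open>4\<close> when \<open>b\<close> or \<open>c\<close> vanishes.
\<close>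

lemma card_quartic_level_set_le:
  fixes b c \<mu> :: real
  assumes "\<mu> \<noteq> 0"
  defines "R \<equiv> {t. (1 - t)\<^sup>2 * (1 - c * t) * (1 - b * t) = \<mu>}"
  shows "finite R" "card R \<le> 4"
proof -
  define q where "q = [:1, -1:]\<^sup>2 * [:1, -c:] * [:1, -b:] - [:\<mu>:]"
  have poly_q: "poly q t = (1 - t)\<^sup>2 * (1 - c * t) * (1 - b * t) - \<mu>" for t
    by (simp add: q_def algebra_simps)
  have "poly q 1 \<noteq> 0" using assms(1) by (simp add: poly_q)
  then have "q \<noteq> 0" by auto
  have R: "R = {t. poly q t = 0}" by (auto simp: R_def poly_q)
  show "finite R" using poly_roots_finite[OF \<open>q \<noteq> 0\<close>] R by simp
  have "degree q \<le> 4"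
    unfolding q_def by (simp add: power2_eq_square)
  then show "card R \<le> 4"
    using card_poly_roots_bound[OF \<open>q \<noteq> 0\<close>] R by simp
qed

theorem theorem2p19:
  fixes A :: "real ^ 'n ^ 'n"
    and p :: nat and a :: "nat \<Rightarrow> real"
    and m :: "nat \<Rightarrow> nat" and e :: "nat \<Rightarrow> nat \<Rightarrow> real ^ 'n"
    and \<mu> :: real and u :: "real ^ 'n"
  assumes "invertible A" and "transpose A = A"
    and "inj_on a {1..p}" and "a ` {1..p} = {l. is_eigenvalue A l}"
    and "\<forall>i\<in>{1..p}. orthonormal_basis (eigenspace A (a i)) (m i) (e i)"
    and "\<mu> \<noteq> 0" and "nonlinear_eigenvector A \<mu> u"
  shows "\<exists>(J :: nat set) (c :: nat \<Rightarrow> nat \<Rightarrow> real).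
           J \<subseteq> {1..p} \<and> 2 \<le> card J \<and> card J \<le> 4 \<and>
           (\<forall>i\<in>J. \<exists>s\<in>{1..m i}. c i s \<noteq> 0) \<and>
           u = (\<Sum>i\<in>J. \<Sum>s = 1..m i. c i s *\<^sub>R e i s)"
proof -
  note sym = assms(2)
  have u0: "u \<noteq> 0" and Psi0: "Psi A u \<noteq> 0" and ev: "Upsilon A u *v u = \<mu> *\<^sub>R u"
    using assms(7) by (auto simp: nonlinear_eigenvector_def)
  have in_eig: "e i s \<in> eigenspace A (a i)" if "i \<in> {1..p}" "s \<in> {1..m i}" for i s
    using orthonormal_basis_in assms(5) that by blast
  define c where "c i s = e i s \<bullet> u" for i s
  define J where "J = {i \<in> {1..p}. \<exists>s\<in>{1..m i}. c i s \<noteq> 0}"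
  have Jp: "J \<subseteq> {1..p}" by (auto simp: J_def)
  then have finJ: "finite J" using finite_subset by blast
  have "u = (\<Sum>i = 1..p. \<Sum>s = 1..m i. c i s *\<^sub>R e i s)"
    unfolding c_def using symmetric_eigenbasis_expansion[OF sym assms(3,4)] assms(5) by blast
  also have "\<dots> = (\<Sum>i\<in>J. \<Sum>s = 1..m i. c i s *\<^sub>R e i s)"
    by (rule sum.mono_neutral_right) (auto simp: J_def)
  finally have u_sum: "u = (\<Sum>i\<in>J. \<Sum>s = 1..m i. c i s *\<^sub>R e i s)" .

  have card_le: "card J \<le> 4"
  proof -
    let ?R = "{t. (1 - t)\<^sup>2 * (1 - alpha A (Psi A u) * t) * (1 - alpha A u * t) = \<mu>}"
    have "a i \<in> ?R" if i: "i \<in> J" for i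
    proof -
      obtain s where s: "i \<in> {1..p}" "s \<in> {1..m i}" "e i s \<bullet> u \<noteq> 0"
        using i unfolding J_def c_def by blast
      then show ?thesis
        using inner_eigenvector_Upsilon[OF sym in_eig[OF s(1,2)], of u u] by (simp add: ev)
    qed
    then have "card (a ` J) \<le> card ?R"
      using card_quartic_level_set_le(1)[OF assms(6)] by (intro card_mono) auto
    moreover have "card (a ` J) = card J"
      using inj_on_subset[OF assms(3) Jp] by (rule card_image)
    ultimately show ?thesis
      using card_quartic_level_set_le(2)[OF assms(6), of "alpha A (Psi A u)" "alpha A u"]
      by linarith
  qed

  have card_ge: "2 \<le> card J"
  proof (rule ccontr)
    assume "\<not> 2 \<le> card J"
    moreover have "J \<noteq> {}" using u_sum u0 by auto
    then have "card J \<noteq> 0" using finJ by simp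
    ultimately have "card J = 1" by linarith
    then obtain j where J: "J = {j}" by (auto simp: card_1_singleton_iff)
    then have jp: "j \<in> {1..p}" using Jp by simp
    have "(\<Sum>s = 1..m j. c j s *\<^sub>R e j s) \<in> span (e j ` {1..m j})"
      by (intro span_sum span_scale span_base) auto
    then have u_eig: "u \<in> eigenspace A (a j)"
      using u_sum assms(5) jp J by (auto simp: orthonormal_basis_def)
    then have Au: "A *v u = a j *\<^sub>R u" by (simp add: eigenspace_def)
    have "A *v u \<noteq> 0"
      using assms(1) u0 by (metis inj_matrix_vector_mult injD matrix_vector_mult_0_right)
    then have "a j \<noteq> 0" using Au by auto
    then show False using Psi_eigenvector_eq_0[OF u_eig] Psi0 by simp
  qed

  show ?thesis
    using Jp card_ge card_le u_sum by (intro exI[of _ J] exI[of _ c]) (auto simp: J_def)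
qed

end
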